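(* Whenever all the series concerned are either convergent or terminating, $$\sum_{m,n=0}^\infty\frac{(p,m+n)(2p-1,m+n)(-1)^n x^{m+n}}{(p,m)(p,n)}L_m^{(p-1)}(y)\,L_n^{(p-1)}(y)=(1+4x^2y^2)^{1/2-p}.$$
   Context: Here $p$ is a complex parameter and $x,y$ are complex variables. $(\alpha,n)=\alpha(\alpha+1)\cdots(\alpha+n-1)$ for $n\ge1$ and $(\alpha,0)=1$ (Pochhammer symbol). The Laguerre polynomial is $L_n^{(a)}(x)=\frac{(a+1,n)}{n!}\,{}_1F_1[-n;a+1;x]$, where ${}_1F_1[\alpha;\beta;z]=\sum_{k\ge0}\frac{(\alpha,k)}{(\beta,k)}\frac{z^k}{k!}$. *)

theory Defs
  imports "HOL-Analysis.Analysis"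
begin

definition hyp1F1 :: "complex \<Rightarrow> complex \<Rightarrow> complex \<Rightarrow> complex" where
  "hyp1F1 \<alpha> \<beta> z = (\<Sum>k. pochhammer \<alpha> k / pochhammer \<beta> k * (z ^ k / fact k))"

text \<open>For \<open>\<alpha> = - of_nat n\<close> the series terminates, so \<open>suminf\<close> is a finite sum.
  The parameter \<open>a + 1\<close> must not be a non-positive integer (otherwise totalised division
  silently gives unintended values).\<close>

definition Laguerre :: "nat \<Rightarrow> complex \<Rightarrow> complex \<Rightarrow> complex" where
  "Laguerre n a x = pochhammer (a + 1) n / fact n * hyp1F1 (- of_nat n) (a + 1) x"

definition laguerre_product_term ::
    "complex \<Rightarrow> complex \<Rightarrow> complex \<Rightarrow> nat \<Rightarrow> nat \<Rightarrow> complex" where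
  "laguerre_product_term p x y m n =
     pochhammer p (m + n) * pochhammer (2 * p - 1) (m + n) * (-1) ^ n * x ^ (m + n)
       / (pochhammer p m * pochhammer p n)
       * Laguerre m (p - 1) y * Laguerre n (p - 1) y"

text \<open>Principal complex power with \<open>w\<^sup>0 = 1\<close> for every \<open>w\<close>. The library has \<open>0 powr 0 = 0\<close>,
  which is the wrong value for \<open>p = 1/2\<close>, \<open>4 x\<^sup>2 y\<^sup>2 = -1\<close>. For exponents that are natural
  numbers this is the ordinary power.\<close>

definition cpow :: "complex \<Rightarrow> complex \<Rightarrow> complex" where
  "cpow w a = (if a = 0 then 1 else w powr a)"

text \<open>Convergence of a double series to \<open>S\<close> in any of the usual senses: unordered (absolute)
  summation, which includes terminating series; limit of rectangular partial sums;
  summation by total degree \<open>m + n\<close>. The last one matters for series in powers \<open>x ^ (m + n)\<close>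
  whose coefficients are only summable after collecting like powers of \<open>x\<close>.\<close>

definition double_series_sums :: "(nat \<Rightarrow> nat \<Rightarrow> complex) \<Rightarrow> complex \<Rightarrow> bool" where
  "double_series_sums f S \<longleftrightarrow>
     ((\<lambda>(m, n). f m n) has_sum S) UNIV \<or>
     ((\<lambda>(M, N). \<Sum>m<M. \<Sum>n<N. f m n) \<longlongrightarrow> S) (sequentially \<times>\<^sub>F sequentially) \<or>
     (\<lambda>N. \<Sum>m\<le>N. f m (N - m)) sums S"

end

theory Submission
  imports Defs "HOL-Computational_Algebra.Formal_Power_Series"
begin

text \<open>
  Write \<open>F\<^sub>m\<close> for \<open>\<^sub>1F\<^sub>1[-m; p; y]\<close>. Since \<open>\<Sum> F\<^sub>m t\<^sup>m / m!\<close> is \<open>exp t\<close> times the series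
  \<open>B(t) = \<Sum> (-yt)\<^sup>k / (k! (p,k))\<close>, the exponentials cancel in the product at \<open>t\<close> and \<open>-t\<close>, and the
  coefficients of \<open>B(t) B(-t)\<close> are those of \<open>(1 + z)\<^sup>P (1 - z)\<^sup>P = (1 - z\<^sup>2)\<^sup>P\<close> up to normalisation. Hence
  summation over the diagonals \<open>m + n = N\<close> turns the double series into the binomial series of
  \<open>(1 + 4x\<^sup>2y\<^sup>2)\<close> with exponent \<open>1/2 - p\<close>; Abel's limit theorem covers the circle of convergence.

  Unordered summability gives diagonal summability. If only the rectangular partial sums converge,
  the terms with \<open>m = n\<close> are eventually bounded. The three-term recurrence of \<open>F\<^sub>n\<close> prevents it from decaying
  faster than geometrically, whereas the remaining factors grow factorially unless \<open>x = 0\<close> or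
  \<open>(2p - 1, N)\<close> vanishes for large \<open>N\<close>; so the series terminates.
\<close>

unbundle no vec_syntax and fps_syntax

subsection \<open>The binomial series up to its circle of convergence\<close>

text \<open>The weights \<open>(1 - r) * r ^ n\<close> have total mass 1 and move to ever later
  indices as \<open>r\<close> tends to 1. The finite head of the mean is at most
  \<open>(1 - r) * A\<close>, the tail at most \<open>e / 2\<close>.\<close>

lemma tendsto_zero_Abel_mean:
  fixes t :: "nat \<Rightarrow> complex"
  assumes t: "t \<longlonglongrightarrow> 0"
  shows "((\<lambda>r. of_real (1 - r) * (\<Sum>n. t n * of_real r ^ n)) \<longlongrightarrow> 0) (at_left 1)"
proof (rule tendstoI)
  fix e :: real
  assume e: "e > 0"
  from t have "\<forall>\<^sub>F n in sequentially. dist (t n) 0 < e / 2"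
    using e by (intro tendstoD) auto
  then obtain N where N: "\<And>n. n \<ge> N \<Longrightarrow> norm (t n) < e / 2"
    by (auto simp: eventually_sequentially)
  define A where "A = (\<Sum>n<N. norm (t n))"
  have A0: "A \<ge> 0" by (simp add: A_def sum_nonneg)
  have bound: "dist (of_real (1 - r) * (\<Sum>n. t n * of_real r ^ n)) 0 < e"
    if r: "0 < r" "r < 1" "1 - r < e / (2 * (A + 1))" for r
  proof -
    define b where "b n = (if n < N then norm (t n) else 0) + e / 2 * r ^ n" for n
    have "(\<lambda>n. if n \<in> {..<N} then norm (t n) else 0) sums A"
      unfolding A_def by (rule sums_If_finite_set) auto
    moreover have "(\<lambda>n. e / 2 * r ^ n) sums (e / 2 * (1 / (1 - r)))"
      using r by (intro sums_mult geometric_sums) auto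
    ultimately have b: "b sums (A + e / 2 * (1 / (1 - r)))"
      using sums_add unfolding b_def by fastforce
    have le: "norm (t n * of_real r ^ n) \<le> b n" for n
    proof (cases "n < N")
      case True
      have "norm (t n) * r ^ n \<le> norm (t n)"
        using r by (simp add: mult_left_le power_le_one)
      then show ?thesis using True r e by (simp add: b_def norm_mult norm_power add_increasing2)
    next
      case False
      then show ?thesis using N[of n] r by (simp add: b_def norm_mult norm_power)
    qed
    have "norm (\<Sum>n. t n * of_real r ^ n) \<le> (\<Sum>n. b n)"
      using b le by (intro norm_suminf_le sums_summable[OF b])
    also have "\<dots> = A + e / 2 * (1 / (1 - r))"
      using b by (rule sums_unique[symmetric])
    finally have "(1 - r) * norm (\<Sum>n. t n * of_real r ^ n) \<le> (1 - r) * (A + e / 2 * (1 / (1 - r)))"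
      using r by (intro mult_left_mono) auto
    also have "\<dots> = (1 - r) * A + e / 2" using r by (simp add: field_simps)
    also have "(1 - r) * A < e / 2"
    proof -
      have "(1 - r) * A \<le> (1 - r) * (A + 1)" using r by (intro mult_left_mono) auto
      also have "\<dots> < e / 2" using r A0 by (simp add: field_simps)
      finally show ?thesis .
    qed
    finally show ?thesis using r
      by (simp add: norm_mult del: of_real_diff)
  qed
  \<comment> \<open>The \<open>min 1\<close> keeps \<open>r > 1 - d\<close> positive; the other
    bound makes the head smaller than \<open>e / 2\<close>.\<close>
  define d where "d = min 1 (e / (2 * (A + 1)))"
  have "d > 0" using e A0 by (simp add: d_def)
  then have "\<forall>\<^sub>F r in at_left 1. r \<in> {1 - d<..<1}"
    by (intro eventually_at_left_real) auto
  then show "\<forall>\<^sub>F r in at_left 1. dist (of_real (1 - r) * (\<Sum>n. t n * of_real r ^ n)) 0 < e"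
    by eventually_elim (rule bound, auto simp: d_def)
qed

text \<open>Summation by parts: with \<open>t\<close> the error of the partial sums,
  \<open>u n = t (Suc n) - t n\<close>, so the power series is \<open>S\<close> plus an Abel mean of
  a null sequence, up to a factor \<open>1 / r\<close>.\<close>

theorem Abel_limit:
  fixes u :: "nat \<Rightarrow> complex"
  assumes u: "u sums S"
  shows "((\<lambda>r. \<Sum>n. u n * of_real r ^ n) \<longlongrightarrow> S) (at_left 1)"
proof -
  \<comment> \<open>The sum stops before \<open>n\<close>, so \<open>t 0 = - S\<close>: this initial
    term produces the \<open>S\<close> in \<open>eq\<close>, and the index shift produces the
    division by \<open>r\<close>.\<close>
  define t where "t n = (\<Sum>k<n. u k) - S" for n
  have t0: "t \<longlonglongrightarrow> 0"
    unfolding t_def using u by (simp add: sums_def LIM_zero)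
  have eq: "(\<Sum>n. u n * of_real r ^ n) = (S + of_real (1 - r) * (\<Sum>n. t n * of_real r ^ n)) / of_real r"
    if r: "0 < r" "r < 1" for r
  proof -
    obtain M where M: "\<And>n. norm (t n) \<le> M"
      using convergent_imp_Bseq[OF convergentI[OF t0]] by (auto simp: Bseq_def)
    have "summable (\<lambda>n. norm (t n) * r ^ n)"
    proof (rule summable_comparison_test')
      show "summable (\<lambda>n. M * r ^ n)" using r by (intro summable_mult summable_geometric) auto
      show "norm (norm (t n) * r ^ n) \<le> M * r ^ n" if "n \<ge> 0" for n
        using M[of n] r by (simp add: mult_right_mono)
    qed
    then have sm: "summable (\<lambda>n. t n * of_real r ^ n)"
      using r by (intro summable_norm_cancel[of "\<lambda>n. t n * of_real r ^ n"])
                 (simp add: norm_mult norm_power)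
    let ?T = "\<Sum>n. t n * of_real r ^ n"
    have T: "(\<lambda>n. t n * of_real r ^ n) sums ?T" using sm by (rule summable_sums)
    then have "(\<lambda>n. t (Suc n) * of_real r ^ Suc n) sums (?T - t 0 * of_real r ^ 0)"
      by (subst sums_Suc_iff) auto
    then have "(\<lambda>n. t (Suc n) * of_real r ^ Suc n - of_real r * (t n * of_real r ^ n))
        sums ((?T - t 0 * of_real r ^ 0) - of_real r * ?T)"
      by (intro sums_diff sums_mult T)
    then have "(\<lambda>n. (t (Suc n) * of_real r ^ Suc n - of_real r * (t n * of_real r ^ n)) / of_real r)
        sums (((?T - t 0 * of_real r ^ 0) - of_real r * ?T) / of_real r)"
      by (rule sums_divide)
    moreover have "(t (Suc n) * of_real r ^ Suc n - of_real r * (t n * of_real r ^ n)) / of_real r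
        = u n * of_real r ^ n" for n
      using r by (simp add: t_def field_simps)
    moreover have "((?T - t 0 * of_real r ^ 0) - of_real r * ?T) = S + of_real (1 - r) * ?T"
      by (simp add: t_def algebra_simps)
    ultimately show ?thesis by (simp add: sums_iff)
  qed
  have "((\<lambda>r::real. (S + of_real (1 - r) * (\<Sum>n. t n * of_real r ^ n)) / of_real r)
          \<longlongrightarrow> (S + 0) / of_real 1) (at_left 1)"
    by (intro tendsto_intros tendsto_zero_Abel_mean t0) auto
  moreover have "\<forall>\<^sub>F r::real in at_left 1. r \<in> {0<..<1}"
    by (intro eventually_at_left_real) auto
  then have "\<forall>\<^sub>F r in at_left 1. (S + of_real (1 - r) * (\<Sum>n. t n * of_real r ^ n)) / of_real r
      = (\<Sum>n. u n * of_real r ^ n)"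
    by eventually_elim (simp add: eq)
  ultimately show ?thesis
    using Lim_transform_eventually by fastforce
qed

text \<open>Serves the boundary point \<open>w = -1\<close>, where the Abel limit runs into the
  branch point of the power. Existence of the limit is assumed, so no case distinction on
  \<open>Re a\<close> arises.\<close>

lemma limit_powr_at_zero:
  fixes a S :: complex
  assumes a: "a \<noteq> 0"
    and lim: "((\<lambda>t::real. of_real t powr a) \<longlongrightarrow> S) (at_right 0)"
  shows "S = 0"
proof (rule ccontr)
  assume S: "S \<noteq> 0"
  \<comment> \<open>Rescaling \<open>t\<close> by \<open>c\<close> multiplies the limit by \<open>c\<^sup>a\<close>, and \<open>c\<^sup>a = exp (a / \<bar>a\<bar>) \<noteq> 1\<close>.\<close>
  define c where "c = exp (1 / norm a)"
  have c: "c > 0" by (simp add: c_def)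
  have "filterlim (\<lambda>t::real. c * t) (at_right 0) (at_right 0)"
    unfolding filterlim_at using c
    by (auto intro!: tendsto_eq_intros simp: eventually_at_filter)
  then have 1: "((\<lambda>t::real. of_real (c * t) powr a) \<longlongrightarrow> S) (at_right 0)"
    by (rule filterlim_compose[OF lim])
  have "((\<lambda>t::real. of_real c powr a * of_real t powr a) \<longlongrightarrow> of_real c powr a * S) (at_right 0)"
    by (intro tendsto_intros lim)
  moreover have "\<forall>\<^sub>F t::real in at_right 0. of_real c powr a * of_real t powr a = of_real (c * t) powr a"
    using eventually_at_right_less[of "0::real"]
    by eventually_elim (use c in \<open>simp add: powr_times_real\<close>)
  ultimately have "((\<lambda>t::real. of_real (c * t) powr a) \<longlongrightarrow> of_real c powr a * S) (at_right 0)"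
    by (rule Lim_transform_eventually)
  with 1 have "of_real c powr a * S = S"
    by (intro tendsto_unique[OF _ _ 1]) auto
  then have "of_real c powr a = 1" using S by simp
  then have e: "exp (a / of_real (norm a)) = 1"
    using c by (simp add: powr_def Ln_of_real c_def)
  then obtain n :: int where n: "Re (a / of_real (norm a)) = 0" "Im (a / of_real (norm a)) = of_int (2 * n) * pi"
    by (auto simp: exp_eq_1)
  define b where "b = a / of_real (norm a)"
  have "norm b = 1" using a by (simp add: b_def norm_divide)
  then have "\<bar>of_int (2 * n) * pi\<bar> = 1"
    using n unfolding b_def[symmetric] by (simp add: cmod_def)
  moreover have "\<bar>of_int (2 * n) * pi\<bar> = 0 \<or> \<bar>of_int (2 * n) * pi\<bar> > 1"
  proof (cases "n = 0")
    case False
    then have "\<bar>real_of_int (2 * n)\<bar> \<ge> 1" by linarith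
    then have "\<bar>real_of_int (2 * n)\<bar> * pi \<ge> 1 * pi" by (intro mult_right_mono) auto
    moreover have "\<bar>of_int (2 * n) * pi\<bar> = \<bar>real_of_int (2 * n)\<bar> * pi" by (simp add: abs_mult)
    ultimately show ?thesis using pi_gt3 by linarith
  qed auto
  ultimately show False by simp
qed

text \<open>For natural \<open>a\<close> the series is a polynomial identity in \<open>w\<close>.
  Otherwise the radius of convergence is 1, so \<open>w\<close> lies in the closed unit disc and the
  value is the radial limit from inside. Only at \<open>w = -1\<close> does \<open>1 + w\<close>
  meet the branch cut.\<close>

theorem gbinomial_series_sums_imp_cpow:
  fixes a w S :: complex
  assumes sums: "(\<lambda>n. (a gchoose n) * w ^ n) sums S"
  shows "S = cpow (1 + w) a"
proof (cases "a \<in> \<nat>")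
  case True
  then obtain j where j: "a = of_nat j" by (auto simp: Nats_def)
  have "(\<lambda>n. (a gchoose n) * w ^ n) sums (\<Sum>n\<le>j. (a gchoose n) * w ^ n)"
    by (rule sums_finite) (auto simp: j binomial_gbinomial[symmetric])
  also have "(\<Sum>n\<le>j. (a gchoose n) * w ^ n) = (w + 1) ^ j"
    by (simp add: binomial_ring j binomial_gbinomial)
  finally have "S = (1 + w) ^ j"
    using sums by (simp add: sums_unique2 add.commute)
  then show ?thesis
    by (cases "1 + w = 0"; cases "j = 0") (auto simp: cpow_def j powr_nat')
next
  case False
  then have a0: "a \<noteq> 0" by auto
  have "norm w \<le> 1"
    using conv_radius_geI[OF sums_summable[OF sums]] False by (simp add: conv_radius_gchoose)
  have inside: "(\<Sum>n. (a gchoose n) * w ^ n * of_real r ^ n) = (1 + of_real r * w) powr a"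
    if "0 < r" "r < 1" for r
  proof -
    have "norm (of_real r * w) \<le> r * 1"
      unfolding norm_mult using that \<open>norm w \<le> 1\<close> by (intro mult_mono) auto
    then have "(\<lambda>n. (a gchoose n) * (of_real r * w) ^ n) sums (1 + of_real r * w) powr a"
      using that by (intro gen_binomial_complex) auto
    then show ?thesis by (simp add: sums_iff power_mult_distrib mult_ac)
  qed
  have "\<forall>\<^sub>F r::real in at_left 1. r \<in> {0<..<1}"
    by (intro eventually_at_left_real) auto
  then have "\<forall>\<^sub>F r in at_left 1. (\<Sum>n. (a gchoose n) * w ^ n * of_real r ^ n) = (1 + of_real r * w) powr a"
    by eventually_elim (simp add: inside)
  then have lim: "((\<lambda>r::real. (1 + of_real r * w) powr a) \<longlongrightarrow> S) (at_left 1)"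
    by (rule Lim_transform_eventually[OF Abel_limit[OF sums]])
  show ?thesis
  proof (cases "w = -1")
    case True
    have "filterlim (\<lambda>t::real. 1 - t) (at_left 1) (at_right 0)"
      unfolding filterlim_at by (auto intro!: tendsto_eq_intros simp: eventually_at_filter)
    from filterlim_compose[OF lim this]
    have "((\<lambda>t::real. of_real t powr a) \<longlongrightarrow> S) (at_right 0)"
      by (simp add: True)
    then show ?thesis using limit_powr_at_zero[OF a0] a0 by (simp add: cpow_def True)
  next
    case False
    have "1 + w \<notin> \<real>\<^sub>\<le>\<^sub>0"
    proof
      assume "1 + w \<in> \<real>\<^sub>\<le>\<^sub>0"
      then have "Re w \<le> -1" "Im w = 0" by (auto simp: complex_nonpos_Reals_iff)
      moreover have "\<bar>Re w\<bar> \<le> 1" using abs_Re_le_cmod[of w] \<open>norm w \<le> 1\<close> by linarith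
      ultimately have "w = -1" by (intro complex_eqI) auto
      with False show False ..
    qed
    then have "((\<lambda>r::real. (1 + of_real r * w) powr a) \<longlongrightarrow> (1 + of_real 1 * w) powr a) (at_left 1)"
      by (intro tendsto_intros tendsto_ident_at) auto
    then show ?thesis
      using tendsto_unique[OF _ lim] a0 by (simp add: cpow_def)
  qed
qed

subsection \<open>Convolution identities\<close>

lemma gbinomial_alternating_convolution:
  fixes P :: "'a :: field_char_0"
  shows "(\<Sum>i=0..n. (-1) ^ i * (P gchoose i) * (P gchoose (n - i))) =
           (if even n then (-1) ^ (n div 2) * (P gchoose (n div 2)) else 0)"
proof -
  define A where "A = fps_binomial P"
  define B where "B = Abs_fps (\<lambda>n. (-1) ^ n * (P gchoose n))"
  define H where "H = B * A"
  \<comment> \<open>\<open>H = (1 - X\<^sup>2)\<^sup>P\<close>, which is used through its differential equation.\<close>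
  have nth: "H $ n = (\<Sum>i=0..n. (-1) ^ i * (P gchoose i) * (P gchoose (n - i)))" for n
    by (simp add: H_def A_def B_def fps_mult_nth)
  have A: "(1 + fps_X) * fps_deriv A = fps_const P * A"
  proof (rule fps_ext)
    fix n show "((1 + fps_X) * fps_deriv A) $ n = (fps_const P * A) $ n"
      using gbinomial_mult_1[of P n]
      by (cases n) (auto simp: A_def ring_distribs add.commute)
  qed
  have B: "(1 - fps_X) * fps_deriv B = - (fps_const P * B)"
  proof (rule fps_ext)
    fix n
    have "(-1) ^ n * (P * (P gchoose n)) =
      (-1) ^ n * (of_nat n * (P gchoose n) + of_nat (Suc n) * (P gchoose Suc n))"
      by (subst gbinomial_mult_1) simp
    then show "((1 - fps_X) * fps_deriv B) $ n = (- (fps_const P * B)) $ n"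
      by (cases n) (simp_all add: B_def algebra_simps)
  qed
  have "(1 - fps_X ^ 2) * fps_deriv H =
      ((1 - fps_X) * fps_deriv B) * ((1 + fps_X) * A)
      + ((1 + fps_X) * fps_deriv A) * ((1 - fps_X) * B)"
    by (simp add: H_def algebra_simps power2_eq_square)
  also have "\<dots> = - (fps_const (2 * P) * fps_X * H)"
    unfolding A B by (simp add: H_def algebra_simps fps_const_mult[symmetric]
        numeral_fps_const[symmetric] del: fps_const_mult)
  finally have ode: "(1 - fps_X ^ 2) * fps_deriv H = - (fps_const (2 * P) * fps_X * H)" .
  \<comment> \<open>Comparing coefficients of degree \<open>n + 1\<close> in \<open>ode\<close>
    links only indices of equal parity: the even ones follow from \<open>H $ 0 = 1\<close>, the odd
    ones vanish with \<open>H $ 1\<close>.\<close>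
  have rec: "of_nat (n + 2) * H $ (n + 2) = (of_nat n - 2 * P) * H $ n" for n
  proof -
    have "((1 - fps_X ^ 2) * fps_deriv H) $ Suc n = (- (fps_const (2 * P) * fps_X * H)) $ Suc n"
      by (simp only: ode)
    then show ?thesis
      by (cases n) (simp_all add: left_diff_distrib fps_X_power_mult_nth fps_X_power_mult_right_nth mult.assoc algebra_simps)
  qed
  have "H $ (2 * k) = (-1) ^ k * (P gchoose k)" for k
  proof (induction k)
    case 0
    show ?case by (simp add: nth)
  next
    case (Suc k)
    have "2 * (of_nat (Suc k) * H $ (2 * Suc k)) = 2 * ((of_nat k - P) * H $ (2 * k))"
      using rec[of "2 * k"] by (simp add: algebra_simps)
    also have "(of_nat k - P) * H $ (2 * k) = (-1) ^ Suc k * (P * (P gchoose k) - of_nat k * (P gchoose k))"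
      unfolding Suc.IH by (simp add: algebra_simps)
    also have "\<dots> = of_nat (Suc k) * ((-1) ^ Suc k * (P gchoose Suc k))"
      unfolding gbinomial_mult_1[of P k] by simp
    finally show ?case
      by (simp only: mult_cancel_left) (simp add: of_nat_neq_0 del: of_nat_Suc)
  qed
  moreover have "H $ (2 * k + 1) = 0" for k
  proof (induction k)
    case 0
    show ?case by (simp add: nth)
  next
    case (Suc k)
    then show ?case using rec[of "2 * k + 1"] of_nat_neq_0[of "2 * k + 2", where ?'a = 'a]
      by (simp del: of_nat_Suc of_nat_add)
  qed
  ultimately show ?thesis
    unfolding nth[symmetric] by (cases "even n") (auto elim!: evenE oddE)
qed

text \<open>The falling factorial of length \<open>i\<close> from \<open>p + n - 1\<close> is the
  top part of \<open>(p, n)\<close>. Applied to \<open>i\<close> and \<open>n - i\<close>, this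
  makes the denominators in the coefficients of \<open>B(t) B(-t)\<close> a product of two
  binomials.\<close>

lemma gbinomial_eq_pochhammer_quotient:
  fixes p :: "'a :: field_char_0"
  assumes "i \<le> n" "pochhammer p (n - i) \<noteq> 0"
  shows "(p + of_nat n - 1) gchoose i = pochhammer p n / (fact i * pochhammer p (n - i))"
  using assms pochhammer_product[of "n - i" n p]
  by (simp add: gbinomial_pochhammer' of_nat_diff algebra_simps)

lemma hyp1F1_neg_of_nat:
  "hyp1F1 (- of_nat n) p y = (\<Sum>k=0..n. of_nat (n choose k) * (- y) ^ k / pochhammer p k)"
proof -
  have eq: "pochhammer (- of_nat n) k / pochhammer p k * (y ^ k / fact k)
      = of_nat (n choose k) * (- y) ^ k / pochhammer p k" for k
  proof -
    have "pochhammer (- of_nat n) k = (-1) ^ k * (fact k * of_nat (n choose k) :: complex)"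
      by (simp add: binomial_gbinomial gbinomial_pochhammer)
    then show ?thesis
      by (simp add: power_minus[of y] mult_ac)
  qed
  show ?thesis
    unfolding hyp1F1_def eq by (rule suminf_finite) auto
qed

subsection \<open>Double series\<close>

lemma has_sum_imp_diagonal_sums:
  fixes f :: "nat \<Rightarrow> nat \<Rightarrow> complex"
  assumes "((\<lambda>(m, n). f m n) has_sum S) UNIV"
  shows "(\<lambda>N. \<Sum>m\<le>N. f m (N - m)) sums S"
proof -
  have bij: "bij_betw (\<lambda>(N, m). (m, N - m)) (SIGMA N:UNIV. {..N}) (UNIV :: (nat \<times> nat) set)"
    by (rule bij_betwI[where g = "\<lambda>(m, n). (m + n, m)"]) auto
  have "((\<lambda>(N, m). f m (N - m)) has_sum S) (SIGMA N:UNIV. {..N})"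
    using has_sum_reindex_bij_betw[OF bij, of "\<lambda>(m, n). f m n" S] assms
    by (simp add: case_prod_unfold)
  then have "((\<lambda>N. \<Sum>m\<le>N. f m (N - m)) has_sum S) UNIV"
    by (rule has_sum_SigmaD) (auto intro: has_sum_finite)
  then show ?thesis by (rule has_sum_imp_sums)
qed

text \<open>A single term is a second difference of rectangular partial sums; its four corners all
  lie within 1 of \<open>S\<close>.\<close>

lemma rectangular_limit_imp_bounded:
  fixes f :: "nat \<Rightarrow> nat \<Rightarrow> 'a :: real_normed_vector"
  assumes "((\<lambda>(M, N). \<Sum>m<M. \<Sum>n<N. f m n) \<longlongrightarrow> S) (sequentially \<times>\<^sub>F sequentially)"
  obtains K where "\<And>m n. m \<ge> K \<Longrightarrow> n \<ge> K \<Longrightarrow> norm (f m n) \<le> 4"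
proof -
  define R where "R M N = (\<Sum>m<M. \<Sum>n<N. f m n)" for M N
  have "\<forall>\<^sub>F (M, N) in sequentially \<times>\<^sub>F sequentially. dist (R M N) S < 1"
    using tendstoD[OF assms, of 1] by (simp add: R_def case_prod_unfold)
  then obtain K where K: "\<And>M N. M \<ge> K \<Longrightarrow> N \<ge> K \<Longrightarrow> norm (R M N - S) < 1"
    by (auto simp: eventually_prod_sequentially dist_norm)
  have "norm (f m n) \<le> 4" if "m \<ge> K" "n \<ge> K" for m n
  proof -
    have "f m n = ((R (Suc m) (Suc n) - S) - (R m (Suc n) - S)) - ((R (Suc m) n - S) - (R m n - S))"
      by (simp add: R_def)
    moreover have "norm ((a - b) - (c - d)) \<le> (norm a + norm b) + (norm c + norm d)" for a b c d :: 'a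
      by (intro order.trans[OF norm_triangle_ineq4] add_mono norm_triangle_ineq4)
    ultimately have "norm (f m n) \<le> norm (R (Suc m) (Suc n) - S) + norm (R m (Suc n) - S)
        + (norm (R (Suc m) n - S) + norm (R m n - S))"
      by metis
    then show ?thesis
      using that K[of "Suc m" "Suc n"] K[of m "Suc n"] K[of "Suc m" n] K[of m n] by simp
  qed
  then show ?thesis by (rule that)
qed

lemma finite_support_rectangular_limit_imp_has_sum:
  fixes f :: "nat \<Rightarrow> nat \<Rightarrow> 'a :: real_normed_vector"
  assumes zero: "\<And>m n. m + n \<ge> K \<Longrightarrow> f m n = 0"
    and lim: "((\<lambda>(M, N). \<Sum>m<M. \<Sum>n<N. f m n) \<longlongrightarrow> S) (sequentially \<times>\<^sub>F sequentially)"
  shows "((\<lambda>(m, n). f m n) has_sum S) UNIV"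
proof -
  define T where "T = (\<Sum>(m, n)\<in>{..<K} \<times> {..<K}. f m n)"
  have out: "f m n = 0" if "(m, n) \<notin> {..<K} \<times> {..<K}" for m n
    using that by (intro zero) auto
  have "(\<Sum>m<M. \<Sum>n<N. f m n) = T" if "M \<ge> K" "N \<ge> K" for M N
    unfolding T_def sum.cartesian_product
    by (rule sum.mono_neutral_right) (use that out in auto)
  then have "\<forall>\<^sub>F MN in sequentially \<times>\<^sub>F sequentially. (\<lambda>(M, N). \<Sum>m<M. \<Sum>n<N. f m n) MN = T"
    unfolding eventually_prod_sequentially by auto
  then have "((\<lambda>(M, N). \<Sum>m<M. \<Sum>n<N. f m n) \<longlongrightarrow> T) (sequentially \<times>\<^sub>F sequentially)"
    by (rule tendsto_eventually)
  then have "S = T"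
    by (intro tendsto_unique[OF _ lim]) (auto simp: prod_filter_eq_bot)
  moreover have "((\<lambda>(m, n). f m n) has_sum T) UNIV"
    by (rule has_sum_finite_neutralI[of "{..<K} \<times> {..<K}"]) (use out in \<open>auto simp: T_def\<close>)
  ultimately show ?thesis by simp
qed

section \<open>Growth and decay estimates\<close>

text \<open>Coefficient form of the three-term recurrence of the polynomials \<open>F\<close>, at
  index \<open>Suc k\<close>. The factor \<open>p + k\<close> on the right is the one by which
  \<open>(p, k + 1)\<close> exceeds \<open>(p, k)\<close>.\<close>

lemma binomial_three_term:
  fixes p :: "'a :: comm_ring_1"
  shows "(p + of_nat (Suc n)) * of_nat (Suc (Suc n) choose Suc k)
      - (2 * of_nat (Suc n) + p) * of_nat (Suc n choose Suc k) + of_nat (Suc n) * of_nat (n choose Suc k)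
    = (p + of_nat k) * of_nat (Suc n choose k)"
proof -
  have "k * (Suc n choose k) + Suc n * (n choose k) = Suc n * (Suc n choose k)"
  proof (cases k)
    case (Suc j)
    then show ?thesis using Suc_times_binomial_eq[of n j] by (simp add: algebra_simps)
  qed auto
  then have "of_nat (k * (Suc n choose k) + Suc n * (n choose k)) = (of_nat (Suc n * (Suc n choose k)) :: 'a)"
    by (rule arg_cong)
  then have "of_nat k * of_nat (Suc n choose k) =
      of_nat (Suc n) * of_nat (Suc n choose k) - of_nat (Suc n) * (of_nat (n choose k) :: 'a)"
    by (simp only: of_nat_add of_nat_mult) (metis add_diff_cancel)
  then show ?thesis
    unfolding distrib_right[of p "of_nat k"]
    by (simp del: of_nat_Suc add: algebra_simps)
qed

text \<open>Read backwards, the maximum of two consecutive values grows by at most a factor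
  \<open>C\<close> per step. Pairs are tracked because individual values may vanish.\<close>

lemma one_le_max_growth:
  fixes u :: "nat \<Rightarrow> real"
  assumes C: "C \<ge> 1" and u0: "u 0 = 1"
    and step: "\<And>n. u n \<le> C * max (u (Suc n)) (u (Suc (Suc n)))" and pos: "\<And>n. u n \<ge> 0"
  shows "1 \<le> C ^ n * max (u n) (u (Suc n))"
proof (induction n)
  case 0
  show ?case by (simp add: u0)
next
  case (Suc n)
  have "u (Suc n) * 1 \<le> max (u (Suc n)) (u (Suc (Suc n))) * C"
    using C pos by (intro mult_mono) (auto simp: le_max_iff_disj)
  then have "max (u n) (u (Suc n)) \<le> C * max (u (Suc n)) (u (Suc (Suc n)))"
    using step[of n] by (simp add: mult.commute)
  then have "C ^ n * max (u n) (u (Suc n)) \<le> C ^ n * (C * max (u (Suc n)) (u (Suc (Suc n))))"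
    using C by (intro mult_left_mono) auto
  with Suc.IH show ?case by (simp add: mult_ac)
qed

text \<open>Ratio test: from \<open>n\<close> to \<open>n + 1\<close> the numerator gains a factor
  of order \<open>n\<close> squared, the denominator four linear factors, so the quotient is of
  order \<open>1 / n\<close> squared.\<close>

lemma factorial_decay:
  fixes p x :: complex
  assumes x: "x \<noteq> 0" and D: "D > 0"
    and nz: "\<And>n. pochhammer p n \<noteq> 0" "\<And>n. pochhammer (2 * p - 1) n \<noteq> 0"
  shows "(\<lambda>n. of_real D ^ n * (fact n)\<^sup>2 /
           (pochhammer p (2 * n) * pochhammer (2 * p - 1) (2 * n) * x ^ (2 * n))) \<longlonglongrightarrow> 0"
    (is "?b \<longlonglongrightarrow> 0")
proof -
  define q where "q n = norm (p + of_nat (2 * n)) * norm (p + of_nat (2 * n + 1)) *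
      (norm (2 * p - 1 + of_nat (2 * n)) * norm (2 * p - 1 + of_nat (2 * n + 1)) * (norm x)\<^sup>2)" for n
  \<comment> \<open>The summand \<open>2 * norm p + 2\<close> makes the four linear factors at least
    \<open>n + 1\<close> or \<open>n\<close>; the last summand makes the remaining quotient at most
    1/2.\<close>
  define N where "N = nat \<lceil>2 * norm p + 2 + 2 * D / (norm x)\<^sup>2\<rceil>"
  have ratio: "norm (?b (Suc n)) = norm (?b n) * (D * (real (Suc n))\<^sup>2 / q n)" for n
  proof -
    have 1: "of_real D ^ Suc n * (fact (Suc n))\<^sup>2 =
        (of_real D ^ n * (fact n)\<^sup>2) * (of_real D * (of_nat (Suc n))\<^sup>2 :: complex)"
      by (simp add: power_mult_distrib mult_ac del: of_nat_Suc)
    have 2: "pochhammer z (2 * Suc n) = pochhammer z (2 * n) *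
        ((z + of_nat (2 * n)) * (z + of_nat (2 * n + 1)))" for z :: complex
      by (simp add: pochhammer_Suc mult.assoc)
    have 3: "x ^ (2 * Suc n) = x ^ (2 * n) * x\<^sup>2"
      by (simp add: power2_eq_square)
    define Q where "Q = ((p + of_nat (2 * n)) * (p + of_nat (2 * n + 1))) *
         ((2 * p - 1 + of_nat (2 * n)) * (2 * p - 1 + of_nat (2 * n + 1)) * x\<^sup>2)"
    have b: "?b (Suc n) = ?b n * (of_real D * (of_nat (Suc n))\<^sup>2 / Q)"
      unfolding 1 2 3 times_divide_times_eq Q_def by (simp only: mult.assoc mult.left_commute mult.commute)
    have q: "q n = norm Q"
      by (simp only: q_def Q_def norm_mult norm_power)
    show ?thesis
      unfolding b norm_mult[of "?b n"] q using D
      by (simp only: norm_mult norm_divide norm_power norm_of_nat norm_of_real abs_of_pos)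
  qed
  have "summable ?b"
  proof (rule summable_ratio_test)
    show "(1/2 :: real) < 1" by simp
    fix n assume "n \<ge> N"
    then have n: "real n \<ge> 2 * norm p + 2 + 2 * D / (norm x)\<^sup>2" by (simp add: N_def ceiling_le_iff)
    moreover have "2 * D / (norm x)\<^sup>2 \<ge> 0" using D by simp
    ultimately have n1: "real n \<ge> 2 * norm p + 2" by linarith
    have rev: "norm (z + of_nat k) \<ge> real k - norm z" for z :: complex and k
      using norm_triangle_ineq2[of "of_nat k" "- z"] by (simp add: add.commute)
    have z: "norm (2 * p - 1) \<le> 2 * norm p + 1"
      using norm_triangle_ineq4[of "2 * p" 1] by (simp add: norm_mult)
    have "2 * D / (norm x)\<^sup>2 \<le> real n" using n norm_ge_zero[of p] by linarith
    also have "\<dots> \<le> real n * real n" by (simp flip: of_nat_mult)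
    finally have D2: "2 * D \<le> real n * real n * (norm x)\<^sup>2" using x by (simp add: field_simps)
    have 1: "real (Suc n) \<le> norm (p + of_nat (2 * n))" "real (Suc n) \<le> norm (p + of_nat (2 * n + 1))"
      using rev[of "2 * n" p] rev[of "2 * n + 1" p] n1 norm_ge_zero[of p] by linarith+
    have 2: "real n \<le> norm (2 * p - 1 + of_nat (2 * n))" "real n \<le> norm (2 * p - 1 + of_nat (2 * n + 1))"
      using rev[of "2 * n" "2 * p - 1"] rev[of "2 * n + 1" "2 * p - 1"] n1 z by linarith+
    from D2 have "(real (Suc n) * real (Suc n)) * (2 * D) \<le>
        (real (Suc n) * real (Suc n)) * (real n * real n * (norm x)\<^sup>2)"
      by (intro mult_left_mono) auto
    also have "\<dots> \<le> q n"
      unfolding q_def using 1 2 by (intro mult_mono order.refl) simp_all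
    finally have le: "2 * D * (real (Suc n))\<^sup>2 \<le> q n" by (simp add: power2_eq_square mult_ac)
    moreover have "2 * D * (real (Suc n))\<^sup>2 > 0" using D by simp
    ultimately have "D * (real (Suc n))\<^sup>2 / q n \<le> 1 / 2" by (simp add: field_simps)
    then show "norm (?b (Suc n)) \<le> 1 / 2 * norm (?b n)"
      unfolding ratio by (subst mult.commute) (intro mult_right_mono, auto)
  qed
  then show ?thesis by (rule summable_LIMSEQ_zero)
qed

subsection \<open>Products of Laguerre polynomials\<close>

context
  fixes p :: complex
  assumes p: "\<forall>k::nat. p \<noteq> - of_nat k"
begin

lemma pochhammer_nonzero: "pochhammer p n \<noteq> 0"
  using p by (auto simp: pochhammer_eq_0_iff)

text \<open>The normalisation of the Laguerre polynomials cancels \<open>(p, m)\<close> and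
  \<open>(p, n)\<close>. What remains is a factor in \<open>m + n\<close> alone times a product that
  separates \<open>m\<close> from \<open>n\<close>, so each diagonal sum is a Cauchy product
  coefficient.\<close>

lemma laguerre_product_term_eq:
  "laguerre_product_term p x y m n =
     pochhammer p (m + n) * pochhammer (2 * p - 1) (m + n) * x ^ (m + n) *
     (hyp1F1 (- of_nat m) p y / fact m * ((-1) ^ n * hyp1F1 (- of_nat n) p y / fact n))"
  using pochhammer_nonzero[of m] pochhammer_nonzero[of n]
  by (simp add: laguerre_product_term_def Laguerre_def)

lemma hyp1F1_convolution:
  "(\<Sum>m=0..N. hyp1F1 (- of_nat m) p y / fact m *
       ((-1) ^ (N - m) * hyp1F1 (- of_nat (N - m)) p y / fact (N - m))) =
   (if even N then (-1) ^ (N div 2) * y ^ N /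
      (fact (N div 2) * pochhammer p (N div 2) * pochhammer p N) else 0)"
proof -
  define B where "B c = Abs_fps (\<lambda>k. (- c * y) ^ k / (fact k * pochhammer p k))" for c
  define G where "G c = Abs_fps (\<lambda>m. c ^ m * hyp1F1 (- of_nat m) p y / fact m)" for c
  have G: "G c = B c * fps_exp c" for c
  proof (rule fps_ext)
    fix n
    have "c ^ n * hyp1F1 (- of_nat n) p y / fact n =
      (\<Sum>k=0..n. c ^ n * (of_nat (n choose k) * (- y) ^ k / pochhammer p k) / fact n)"
      by (simp add: hyp1F1_neg_of_nat sum_distrib_left sum_divide_distrib)
    also have "\<dots> = (\<Sum>k=0..n. (- c * y) ^ k / (fact k * pochhammer p k) * (c ^ (n - k) / fact (n - k)))"
    proof (rule sum.cong)
      fix k assume "k \<in> {0..n}"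
      then have "k \<le> n" by simp
      then have "c ^ n = c ^ k * c ^ (n - k)" by (simp flip: power_add)
      moreover have "(- c * y) ^ k = c ^ k * (- y) ^ k"
        by (simp flip: power_mult_distrib)
      moreover have "of_nat (n choose k) / fact n = 1 / (fact k * fact (n - k) :: complex)"
        using \<open>k \<le> n\<close> by (simp add: binomial_fact)
      ultimately show "c ^ n * (of_nat (n choose k) * (- y) ^ k / pochhammer p k) / fact n =
        (- c * y) ^ k / (fact k * pochhammer p k) * (c ^ (n - k) / fact (n - k))"
        by (simp add: divide_simps)
    qed auto
    finally show "G c $ n = (B c * fps_exp c) $ n"
      by (simp add: G_def B_def fps_mult_nth)
  qed
  have "(\<Sum>m=0..N. hyp1F1 (- of_nat m) p y / fact m *
       ((-1) ^ (N - m) * hyp1F1 (- of_nat (N - m)) p y / fact (N - m))) = (G 1 * G (-1)) $ N"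
    by (simp add: fps_mult_nth G_def)
  also have "G 1 * G (-1) = B 1 * B (-1) * (fps_exp 1 * fps_exp (-1))"
    by (simp add: G mult_ac)
  also have "fps_exp 1 * fps_exp (-1) = (1 :: complex fps)"
    by (simp flip: fps_exp_add_mult)
  \<comment> \<open>The upper entry \<open>p + N - 1\<close> changes with \<open>N\<close>, so the
    binomial convolution is applied afresh for each \<open>N\<close>, not as one identity of power
    series.\<close>
  also have "(B 1 * B (-1) * 1) $ N =
      (\<Sum>i=0..N. y ^ N / pochhammer p N ^ 2 *
        ((-1) ^ i * ((p + of_nat N - 1) gchoose i) * ((p + of_nat N - 1) gchoose (N - i))))"
    unfolding mult_1_right fps_mult_nth
  proof (rule sum.cong)
    fix i assume "i \<in> {0..N}"
    then have i: "i \<le> N" by simp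
    then have "y ^ N = y ^ i * y ^ (N - i)" by (simp flip: power_add)
    moreover have "(- y) ^ i = (-1) ^ i * y ^ i" by (rule power_minus)
    ultimately show "B 1 $ i * B (-1) $ (N - i) = y ^ N / pochhammer p N ^ 2 *
        ((-1) ^ i * ((p + of_nat N - 1) gchoose i) * ((p + of_nat N - 1) gchoose (N - i)))"
      using i pochhammer_nonzero
      by (simp add: gbinomial_eq_pochhammer_quotient B_def field_simps power2_eq_square)
  qed auto
  also have "\<dots> = y ^ N / pochhammer p N ^ 2 * (if even N then
      (-1) ^ (N div 2) * ((p + of_nat N - 1) gchoose (N div 2)) else 0)"
    unfolding sum_distrib_left[symmetric] gbinomial_alternating_convolution ..
  also have "\<dots> = (if even N then (-1) ^ (N div 2) * y ^ N /
      (fact (N div 2) * pochhammer p (N div 2) * pochhammer p N) else 0)"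
  proof (cases "even N")
    case True
    then have "N - N div 2 = N div 2" by (auto elim: evenE)
    then have "(p + of_nat N - 1) gchoose (N div 2)
        = pochhammer p N / (fact (N div 2) * pochhammer p (N div 2))"
      using pochhammer_nonzero by (subst gbinomial_eq_pochhammer_quotient) auto
    then show ?thesis
      using True pochhammer_nonzero by (simp add: field_simps power2_eq_square)
  qed simp
  finally show ?thesis .
qed

text \<open>For \<open>N = 2 * k\<close> the duplication formula splits \<open>(2p - 1, N)\<close>
  into \<open>4 ^ k\<close>, \<open>(p - 1/2, k)\<close> and \<open>(p, k)\<close>. The last factor
  and \<open>(p, N)\<close> cancel against the convolution, leaving a binomial coefficient.\<close>

lemma laguerre_product_diagonal:
  "(\<Sum>m\<le>N. laguerre_product_term p x y m (N - m)) =
     (if even N then ((1/2 - p) gchoose (N div 2)) * (4 * x\<^sup>2 * y\<^sup>2) ^ (N div 2) else 0)"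
proof -
  have "(\<Sum>m\<le>N. laguerre_product_term p x y m (N - m)) =
     (\<Sum>m=0..N. pochhammer p N * pochhammer (2 * p - 1) N * x ^ N *
       (hyp1F1 (- of_nat m) p y / fact m *
       ((-1) ^ (N - m) * hyp1F1 (- of_nat (N - m)) p y / fact (N - m))))"
    unfolding laguerre_product_term_eq atLeast0AtMost by (intro sum.cong) auto
  also have "\<dots> = pochhammer p N * pochhammer (2 * p - 1) N * x ^ N *
     (if even N then (-1) ^ (N div 2) * y ^ N /
      (fact (N div 2) * pochhammer p (N div 2) * pochhammer p N) else 0)"
    unfolding sum_distrib_left[symmetric] hyp1F1_convolution ..
  also have "\<dots> = (if even N then ((1/2 - p) gchoose (N div 2)) * (4 * x\<^sup>2 * y\<^sup>2) ^ (N div 2) else 0)"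
  proof (cases "even N")
    case True
    then obtain k where N: "N = 2 * k" by (rule evenE)
    have N2: "N div 2 = k" by (simp add: N)
    have double: "pochhammer (2 * p - 1) N = 4 ^ k * pochhammer (p - 1/2) k * pochhammer p k"
    proof -
      have "2 * (p - 1/2) = 2 * p - 1" "p - 1/2 + 1/2 = p" by (simp_all add: right_diff_distrib)
      moreover have "of_nat (2 ^ (2 * k)) = (4 :: complex) ^ k" unfolding power_mult by simp
      ultimately show ?thesis
        using pochhammer_double[of "p - 1/2" k] unfolding N by (simp only:)
    qed
    have binom: "(1/2 - p) gchoose k = (-1) ^ k * pochhammer (p - 1/2) k / fact k"
      by (simp add: gbinomial_pochhammer)
    have pow: "(4 * x\<^sup>2 * y\<^sup>2) ^ k = 4 ^ k * (x ^ N * y ^ N)"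
      by (simp only: N power_mult power_mult_distrib mult.assoc)
    have cancel: "A * (b * q * K) * X * (s * Y / (f * K * A)) = s * q / f * (b * (X * Y))"
      if "A \<noteq> 0" "K \<noteq> 0" for A b q K X s Y f :: complex
      using that by (cases "f = 0") (auto simp: field_simps)
    show ?thesis
      using True unfolding N2 double binom pow
      by (simp only: cancel[OF pochhammer_nonzero pochhammer_nonzero] if_True)
  qed simp
  finally show ?thesis .
qed

section \<open>Termination under rectangular convergence\<close>

text \<open>Solved for the lowest index, since the growth estimate bounds each value by the two that
  follow.\<close>

lemma hyp1F1_contiguous:
  "of_nat (Suc n) * hyp1F1 (- of_nat n) p y =
     (2 * of_nat (Suc n) + p - y) * hyp1F1 (- of_nat (Suc n)) p y
     - (p + of_nat (Suc n)) * hyp1F1 (- of_nat (Suc (Suc n))) p y"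
proof -
  define c where "c k = (- y) ^ k / pochhammer p k" for k
  have c: "(p + of_nat k) * c (Suc k) = - y * c k" for k
    using pochhammer_nonzero[of k] pochhammer_nonzero[of "Suc k"]
    by (simp add: c_def pochhammer_Suc field_simps)
  have F: "hyp1F1 (- of_nat m) p y = (\<Sum>k\<le>Suc (Suc n). of_nat (m choose k) * c k)"
    if "m \<le> Suc (Suc n)" for m
    unfolding hyp1F1_neg_of_nat using that
    by (intro sum.mono_neutral_cong_left) (auto simp: c_def)
  have "(p + of_nat (Suc n)) * hyp1F1 (- of_nat (Suc (Suc n))) p y
      - (2 * of_nat (Suc n) + p) * hyp1F1 (- of_nat (Suc n)) p y
      + of_nat (Suc n) * hyp1F1 (- of_nat n) p y
    = (\<Sum>k\<le>Suc (Suc n). ((p + of_nat (Suc n)) * of_nat (Suc (Suc n) choose k)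
      - (2 * of_nat (Suc n) + p) * of_nat (Suc n choose k) + of_nat (Suc n) * of_nat (n choose k)) * c k)"
    by (simp only: F order.refl le_SucI sum_distrib_left sum_subtractf[symmetric] sum.distrib[symmetric]
        ring_distribs mult.assoc)
  \<comment> \<open>The \<open>k = 0\<close> term drops out: its coefficient
    \<open>(p + n + 1) - (2 * (n + 1) + p) + (n + 1)\<close> is 0.\<close>
  also have "\<dots> = (\<Sum>k\<le>Suc n. ((p + of_nat k) * of_nat (Suc n choose k)) * c (Suc k))"
    unfolding sum.atMost_Suc_shift[of _ "Suc n"] binomial_three_term by (simp add: algebra_simps)
  also have "\<dots> = (\<Sum>k\<le>Suc n. - y * (of_nat (Suc n choose k) * c k))"
    by (intro sum.cong refl) (metis c mult.assoc mult.commute mult.left_commute)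
  also have "\<dots> = - y * hyp1F1 (- of_nat (Suc n)) p y"
    unfolding hyp1F1_neg_of_nat[of "Suc n"] atLeast0AtMost sum_distrib_left[symmetric] by (simp only: c_def times_divide_eq_right)
  finally show ?thesis by (simp del: of_nat_Suc add: algebra_simps)
qed

lemma hyp1F1_lower_bound:
  obtains C :: real where "C \<ge> 1"
    "\<And>n. 1 \<le> C ^ n * max (norm (hyp1F1 (- of_nat n) p y)) (norm (hyp1F1 (- of_nat (Suc n)) p y))"
proof
  define F where "F n = norm (hyp1F1 (- of_nat n) p y)" for n
  \<comment> \<open>After division of the recurrence by \<open>n + 1\<close> its coefficients are at
    most \<open>2 + norm (p - y)\<close> and \<open>1 + norm p\<close>; \<open>C\<close> is their
    sum.\<close>
  define C where "C = 3 + norm (p - y) + norm p"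
  show C: "C \<ge> 1" by (simp add: C_def add_nonneg_nonneg add_increasing2)
  have F0: "F 0 = 1"
    using hyp1F1_neg_of_nat[of 0 p y] by (simp add: F_def)
  have step: "F n \<le> C * max (F (Suc n)) (F (Suc (Suc n)))" for n
  proof -
    define M where "M = max (F (Suc n)) (F (Suc (Suc n)))"
    have M: "F (Suc n) \<le> M" "F (Suc (Suc n)) \<le> M" "M \<ge> 0" by (auto simp: M_def F_def le_max_iff_disj)
    have "real (Suc n) * F n = norm (of_nat (Suc n) * hyp1F1 (- of_nat n) p y)"
      by (simp only: F_def norm_mult norm_of_nat)
    also have "\<dots> \<le> norm (2 * of_nat (Suc n) + p - y) * F (Suc n) + norm (p + of_nat (Suc n)) * F (Suc (Suc n))"
      unfolding hyp1F1_contiguous F_def norm_mult[symmetric] by (rule norm_triangle_ineq4)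
    also have "\<dots> \<le> (real (Suc n) * (2 + norm (p - y))) * M + (real (Suc n) * (1 + norm p)) * M"
    proof (intro add_mono mult_mono M)
      have "norm (2 * of_nat (Suc n) + (p - y)) \<le> norm (of_nat (2 * Suc n) :: complex) + norm (p - y)"
        using norm_triangle_ineq[of "of_nat (2 * Suc n)" "p - y"] by simp
      also have "\<dots> \<le> real (Suc n) * 2 + real (Suc n) * norm (p - y)"
        unfolding norm_of_nat by (intro add_mono) (auto simp: algebra_simps)
      finally show "norm (2 * of_nat (Suc n) + p - y) \<le> real (Suc n) * (2 + norm (p - y))"
        by (simp add: algebra_simps)
      have "norm (p + of_nat (Suc n)) \<le> norm p + real (Suc n)"
        using norm_triangle_ineq[of p "of_nat (Suc n)"] by (simp only: norm_of_nat)
      moreover have "0 \<le> real n * norm p" by simp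
      moreover have "real (Suc n) * (1 + norm p) = norm p + real (Suc n) + real n * norm p"
        by (simp add: algebra_simps)
      ultimately show "norm (p + of_nat (Suc n)) \<le> real (Suc n) * (1 + norm p)" by linarith
    qed (auto simp: F_def)
    also have "\<dots> = real (Suc n) * (C * M)" by (simp add: C_def algebra_simps)
    finally show ?thesis unfolding M_def by (simp only: mult_le_cancel_left)
  qed
  show "1 \<le> C ^ n * max (norm (hyp1F1 (- of_nat n) p y)) (norm (hyp1F1 (- of_nat (Suc n)) p y))" for n
    unfolding F_def[symmetric]
    by (rule one_le_max_growth[of C F, OF C F0 step]) (simp add: F_def)
qed

text \<open>Unless the series visibly terminates, boundedness on the diagonal \<open>m = n\<close>
  forces \<open>C ^ n * norm F_n\<close> to 0, because the other factors outgrow every geometric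
  sequence. The lower bound for consecutive pairs excludes this.\<close>

lemma laguerre_product_term_bounded_imp_terminating:
  assumes bounded: "\<And>n. n \<ge> K \<Longrightarrow> norm (laguerre_product_term p x y n n) \<le> B"
  obtains L where "\<And>m n. m + n \<ge> L \<Longrightarrow> laguerre_product_term p x y m n = 0"
proof (cases "x \<noteq> 0 \<and> (\<forall>n. pochhammer (2 * p - 1) n \<noteq> 0)")
  case False
  then consider "x = 0" | L where "pochhammer (2 * p - 1) L = 0" by auto
  then show ?thesis
  proof cases
    case 1
    then show ?thesis by (intro that[of 1]) (auto simp: laguerre_product_term_def)
  next
    case 2
    then show ?thesis
      by (intro that[of L]) (auto simp: laguerre_product_term_def dest: pochhammer_eq_0_mono)
  qed
next
  case True
  obtain C where C: "C \<ge> 1" and lower: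
    "\<And>n. 1 \<le> C ^ n * max (norm (hyp1F1 (- of_nat n) p y)) (norm (hyp1F1 (- of_nat (Suc n)) p y))"
    using hyp1F1_lower_bound by blast
  define u where "u n = C ^ n * norm (hyp1F1 (- of_nat n) p y)" for n
  \<comment> \<open>Chosen so that the diagonal term times \<open>b n\<close> is
    \<open>(u n)\<^sup>2\<close> up to sign and the phase of \<open>F_n\<close>.\<close>
  define b where "b n = of_real (C\<^sup>2) ^ n * (fact n)\<^sup>2 /
     (pochhammer p (2 * n) * pochhammer (2 * p - 1) (2 * n) * x ^ (2 * n))" for n
  have b0: "b n \<noteq> 0" for n
    using True C pochhammer_nonzero by (simp add: b_def)
  have "b \<longlonglongrightarrow> 0"
    unfolding b_def using True C pochhammer_nonzero by (intro factorial_decay) auto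
  then have lim: "(\<lambda>n. B * norm (b n)) \<longlonglongrightarrow> 0"
    by (intro tendsto_mult_right_zero tendsto_norm_zero)
  have le: "norm ((u n)\<^sup>2) \<le> B * norm (b n)" if "n \<ge> K" for n
  proof -
    have "laguerre_product_term p x y n n * b n = (-1) ^ n * of_real (C ^ n) ^ 2 * (hyp1F1 (- of_nat n) p y)\<^sup>2"
      using True pochhammer_nonzero[of "2 * n"]
      by (simp add: laguerre_product_term_eq b_def mult_2[symmetric] power2_eq_square
          power_mult_distrib field_simps)
    then have "norm (laguerre_product_term p x y n n) * norm (b n) = (u n)\<^sup>2"
      using C by (simp add: u_def norm_mult[symmetric] power_mult_distrib)
         (simp add: norm_mult norm_power)
    then show ?thesis using bounded[OF that] by (simp add: mult_right_mono flip: \<open>_ = (u n)\<^sup>2\<close>)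
  qed
  have "\<forall>\<^sub>F n in sequentially. norm ((u n)\<^sup>2) \<le> B * norm (b n)"
    using le unfolding eventually_sequentially by blast
  then have "(\<lambda>n. (u n)\<^sup>2) \<longlonglongrightarrow> 0"
    using lim by (rule Lim_null_comparison)
  then have u: "u \<longlonglongrightarrow> 0"
    using tendsto_real_sqrt[of "\<lambda>n. (u n)\<^sup>2" 0] by (simp add: tendsto_rabs_zero_iff)
  have "(\<lambda>n. u n + u (Suc n)) \<longlonglongrightarrow> 0 + 0"
    by (intro tendsto_add u LIMSEQ_Suc)
  moreover have "1 \<le> u n + u (Suc n)" for n
  proof -
    have "C ^ n * norm (hyp1F1 (- of_nat (Suc n)) p y) \<le> u (Suc n)"
      unfolding u_def using C by (intro mult_right_mono power_increasing) auto
    moreover have "u n \<ge> 0" "u (Suc n) \<ge> 0" using C by (simp_all add: u_def)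
    ultimately show ?thesis
      using lower[of n] unfolding u_def by (auto simp: max_def split: if_splits)
  qed
  ultimately have "(1::real) \<le> 0"
    by (intro LIMSEQ_le_const[of "\<lambda>n. u n + u (Suc n)"]) auto
  then show ?thesis by simp
qed

end

theorem mainTheorem7:
  fixes p x y S :: complex
  assumes "\<forall>k::nat. p \<noteq> - of_nat k"
    and "double_series_sums (laguerre_product_term p x y) S"
  shows "S = cpow (1 + 4 * x\<^sup>2 * y\<^sup>2) (1/2 - p)"
proof -
  note p = assms(1)
  let ?f = "laguerre_product_term p x y"
  from assms(2) consider "((\<lambda>(m, n). ?f m n) has_sum S) UNIV"
    | "((\<lambda>(M, N). \<Sum>m<M. \<Sum>n<N. ?f m n) \<longlongrightarrow> S) (sequentially \<times>\<^sub>F sequentially)"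
    | "(\<lambda>N. \<Sum>m\<le>N. ?f m (N - m)) sums S"
    unfolding double_series_sums_def by blast
  then have "(\<lambda>N. \<Sum>m\<le>N. ?f m (N - m)) sums S"
  proof cases
    case 2
    obtain K where "\<And>m n. m \<ge> K \<Longrightarrow> n \<ge> K \<Longrightarrow> norm (?f m n) \<le> 4"
      using rectangular_limit_imp_bounded[OF 2] by blast
    then obtain L where "\<And>m n. m + n \<ge> L \<Longrightarrow> ?f m n = 0"
      using laguerre_product_term_bounded_imp_terminating[OF p, of K x y 4] by blast
    from finite_support_rectangular_limit_imp_has_sum[OF this 2]
    show ?thesis by (rule has_sum_imp_diagonal_sums)
  qed (auto intro: has_sum_imp_diagonal_sums)
  \<comment> \<open>Diagonals of odd degree vanish, so the series may be reindexed by
    \<open>N = 2 * k\<close>.\<close>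
  then have "(\<lambda>k. \<Sum>m\<le>2 * k. ?f m (2 * k - m)) sums S"
    by (subst sums_mono_reindex) (auto simp: strict_mono_def laguerre_product_diagonal[OF p] elim!: evenE)
  then have "(\<lambda>k. ((1/2 - p) gchoose k) * (4 * x\<^sup>2 * y\<^sup>2) ^ k) sums S"
    by (simp add: laguerre_product_diagonal[OF p])
  then show ?thesis by (rule gbinomial_series_sums_imp_cpow)
qed

end
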